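(* There is an absolute constant $K>0$ such that for every $n\ge 1$, every $f:\{0,1\}^n\to\{0,1\}$, every $\epsilon\in[0,1/2)$ and every product distribution $\mu$ on $\{0,1\}^n$, $$D^{\mu}_{4\epsilon}(f)\le K\cdot \mathrm{corr}_{\epsilon}(f)^2 .$$
   Context: Let $f:\{0,1\}^n\to\{0,1\}$ and $[n]=\{1,\dots,n\}$. Distributional query complexity: for a probability distribution $\mu$ on $\{0,1\}^n$ and $\delta\ge 0$, $D^\mu_\delta(f)$ is the minimum, over deterministic query algorithms (decision trees) $\mathcal A$ with $\Pr_{x\sim\mu}[\mathcal A(x)=f(x)]\ge 1-\delta$, of the worst-case (over inputs $x$) number of queried bits of $x$. A product distribution on $\{0,1\}^n$ is a distribution of the form $\mu(x)=\prod_{i\in[n]}\mu_i(x_i)$ with $\mu_i:\{0,1\}\to[0,1]$, $\mu_i(0)+\mu_i(1)=1$. Assignments: an assignment is a map $A:[n]\to\{0,1,*\}$, identified with the subcube $\{x: \forall i,\ x_i=A(i)\text{ or }A(i)=*\}$; $|A|=|\{i:A(i)\ne *\}|$ is its co-dimension. Corruption: for a distribution $\nu$ on $\{0,1\}^n$, $\epsilon\ge 0$ and $b\in\{0,1\}$, an assignment $A$ is an $\epsilon$-error $b$-certificate under $\nu$ if $\Pr_{x\sim\nu}[x\in A]>0$ and $\Pr_{x\sim\nu}[f(x)\ne b\mid x\in A]\le\epsilon$. Let $\mathrm{corr}^{b,\nu}_\epsilon(f)$ be the minimum of $|A|$ over $\epsilon$-error $b$-certificates $A$ under $\nu$. The query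 corruption bound is $\mathrm{corr}_\epsilon(f)=\max_{\nu}\max_{b}\mathrm{corr}^{b,\nu}_\epsilon(f)$, where $\nu$ ranges over all probability distributions on $\{0,1\}^n$ and $b\in\{0,1\}$, the maximum being taken over those pairs $(\nu,b)$ for which an $\epsilon$-error $b$-certificate under $\nu$ exists. *)

theory Defs
  imports "HOL-Probability.Probability"
begin

text \<open>
  The set \<open>[n]\<close> is \<open>{1..n}\<close>. Points of \<open>{0,1}\<^sup>n\<close> are the functions \<open>nat \<Rightarrow> bool\<close> that are
  \<open>False\<close> outside \<open>{1..n}\<close>, which is the convention of \<^const>\<open>Pi_pmf\<close> with default
  value \<open>False\<close>. A Boolean function is any \<open>f :: (nat \<Rightarrow> bool) \<Rightarrow> bool\<close>; everything below
  depends only on its values on \<open>cube n\<close>.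
\<close>

definition cube :: "nat \<Rightarrow> (nat \<Rightarrow> bool) set" where
  "cube n = PiE_dflt {1..n} False (\<lambda>_. UNIV)"

definition distribution_on_cube :: "nat \<Rightarrow> (nat \<Rightarrow> bool) pmf \<Rightarrow> bool" where
  "distribution_on_cube n \<nu> \<longleftrightarrow> set_pmf \<nu> \<subseteq> cube n"

definition product_distribution :: "nat \<Rightarrow> (nat \<Rightarrow> bool) pmf \<Rightarrow> bool" where
  "product_distribution n \<mu> \<longleftrightarrow> (\<exists>p :: nat \<Rightarrow> bool pmf. \<mu> = Pi_pmf {1..n} False p)"


subsection \<open>Distributional query complexity\<close>

datatype dtree = Answer bool | Query nat dtree dtree

primrec tree_vars :: "dtree \<Rightarrow> nat set" where
  "tree_vars (Answer b) = {}"
| "tree_vars (Query i T0 T1) = insert i (tree_vars T0 \<union> tree_vars T1)"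

primrec run :: "dtree \<Rightarrow> (nat \<Rightarrow> bool) \<Rightarrow> bool" where
  "run (Answer b) x = b"
| "run (Query i T0 T1) x = (if x i then run T1 x else run T0 x)"

primrec queried :: "dtree \<Rightarrow> (nat \<Rightarrow> bool) \<Rightarrow> nat set" where
  "queried (Answer b) x = {}"
| "queried (Query i T0 T1) x = insert i (if x i then queried T1 x else queried T0 x)"

definition query_cost :: "nat \<Rightarrow> dtree \<Rightarrow> nat" where
  "query_cost n T = Max ((\<lambda>x. card (queried T x)) ` cube n)"

definition dist_query_complexity ::
    "nat \<Rightarrow> (nat \<Rightarrow> bool) pmf \<Rightarrow> real \<Rightarrow> ((nat \<Rightarrow> bool) \<Rightarrow> bool) \<Rightarrow> nat" where
  "dist_query_complexity n \<mu> \<delta> f =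
     (LEAST k. \<exists>T. tree_vars T \<subseteq> {1..n}
        \<and> measure_pmf.prob \<mu> {x. run T x = f x} \<ge> 1 - \<delta>
        \<and> k = query_cost n T)"


subsection \<open>Corruption\<close>

text \<open>An assignment is a partial map; \<open>A i = None\<close> encodes \<open>A(i) = *\<close>.\<close>

definition assignment :: "nat \<Rightarrow> (nat \<rightharpoonup> bool) \<Rightarrow> bool" where
  "assignment n A \<longleftrightarrow> dom A \<subseteq> {1..n}"

definition subcube :: "nat \<Rightarrow> (nat \<rightharpoonup> bool) \<Rightarrow> (nat \<Rightarrow> bool) set" where
  "subcube n A = {x \<in> cube n. \<forall>i\<in>{1..n}. A i = Some (x i) \<or> A i = None}"

definition codim :: "(nat \<rightharpoonup> bool) \<Rightarrow> nat" where
  "codim A = card (dom A)"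

definition error_certificate ::
    "nat \<Rightarrow> real \<Rightarrow> bool \<Rightarrow> (nat \<Rightarrow> bool) pmf \<Rightarrow> ((nat \<Rightarrow> bool) \<Rightarrow> bool) \<Rightarrow> (nat \<rightharpoonup> bool) \<Rightarrow> bool" where
  "error_certificate n \<epsilon> b \<nu> f A \<longleftrightarrow>
     assignment n A
     \<and> measure_pmf.prob \<nu> (subcube n A) > 0
     \<and> \<P>(x in measure_pmf \<nu>. f x \<noteq> b \<bar> x \<in> subcube n A) \<le> \<epsilon>"

definition corr_under ::
    "nat \<Rightarrow> real \<Rightarrow> bool \<Rightarrow> (nat \<Rightarrow> bool) pmf \<Rightarrow> ((nat \<Rightarrow> bool) \<Rightarrow> bool) \<Rightarrow> nat" where
  "corr_under n \<epsilon> b \<nu> f = (LEAST k. \<exists>A. error_certificate n \<epsilon> b \<nu> f A \<and> k = codim A)"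

text \<open>
  The set below is nonempty for \<open>\<epsilon> \<ge> 0\<close> (take \<open>\<nu>\<close> a point mass) and bounded by \<open>n\<close>,
  so the maximum exists.
\<close>

definition corr :: "nat \<Rightarrow> real \<Rightarrow> ((nat \<Rightarrow> bool) \<Rightarrow> bool) \<Rightarrow> nat" where
  "corr n \<epsilon> f = Max {corr_under n \<epsilon> b \<nu> f | b \<nu>.
     distribution_on_cube n \<nu> \<and> (\<exists>A. error_certificate n \<epsilon> b \<nu> f A)}"

end

theory Submission
  imports Defs
begin

text \<open>
  The maximum over all distributions makes \<open>corr\<close> as large as the certificate complexity: a
  subcube of positive weight with error below \<open>1/2\<close> for the value \<open>f x\<close> under the uniform
  distribution on \<open>{x} \<union> {y. f y \<noteq> f x}\<close> contains \<open>x\<close> and no point \<open>y\<close> with \<open>f y \<noteq> f x\<close>.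
  The theorem then follows from the classical bound of the deterministic query complexity by the
  square of the certificate complexity: query all variables of a 1-certificate consistent with the
  answers so far, which meets every consistent 0-certificate in an unqueried variable, so that
  the 0-certificates are exhausted after at most \<open>corr\<close> rounds.
\<close>

text \<open>A classical exact certificate, kept as its set of variables with the values read off
  \<open>x\<close>, so that intersections and the unqueried part \<open>V - U\<close> are plain set
  operations.\<close>

definition certifies :: "nat \<Rightarrow> ((nat \<Rightarrow> bool) \<Rightarrow> bool) \<Rightarrow> (nat \<Rightarrow> bool) \<Rightarrow> nat set \<Rightarrow> bool" where
  "certifies n f x V \<longleftrightarrow>
     V \<subseteq> {1..n} \<and> (\<forall>y\<in>cube n. (\<forall>i\<in>V. y i = x i) \<longrightarrow> f y = f x)"

lemma mem_cube_iff: "x \<in> cube n \<longleftrightarrow> (\<forall>i. i \<notin> {1..n} \<longrightarrow> \<not> x i)"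
  by (auto simp: cube_def PiE_dflt_def)

lemma finite_cube: "finite (cube n)"
  unfolding cube_def by (rule finite_PiE_dflt) auto

lemma cube_nonempty: "cube n \<noteq> {}"
  using mem_cube_iff[of "\<lambda>_. False" n] by blast

text \<open>The complete binary tree over \<open>V\<close>, continued at each leaf by the tree that
  \<open>F\<close> assigns to the answers. Answers are recorded as a function that is
  \<open>False\<close> outside \<open>V\<close>.\<close>

lemma query_all_tree:
  assumes "finite V"
  shows "\<exists>T. tree_vars T \<subseteq> V \<union> (\<Union>w. tree_vars (F w)) \<and>
           (\<forall>x. run T x = run (F (\<lambda>i. i \<in> V \<and> x i)) x \<and>
                queried T x = V \<union> queried (F (\<lambda>i. i \<in> V \<and> x i)) x)"
  using assms
proof (induction V arbitrary: F rule: finite_induct)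
  case empty
  show ?case by (rule exI[of _ "F (\<lambda>_. False)"]) auto
next
  case (insert j V)
  \<comment> \<open>The answer \<open>b\<close> at the root variable \<open>j\<close> is stored in
    the continuation, so the induction hypothesis is needed for both families
    \<open>G b\<close>.\<close>
  define G where "G b w = F (w(j := b))" for b w
  obtain T where T: "\<And>b. tree_vars (T b) \<subseteq> V \<union> (\<Union>w. tree_vars (G b w))"
    "\<And>b x. run (T b) x = run (G b (\<lambda>i. i \<in> V \<and> x i)) x"
    "\<And>b x. queried (T b) x = V \<union> queried (G b (\<lambda>i. i \<in> V \<and> x i)) x"
    using insert.IH[of "G _"] by metis
  have upd: "G b (\<lambda>i. i \<in> V \<and> x i) = F (\<lambda>i. i \<in> insert j V \<and> x i)" if "x j = b" for b x
  proof -
    have "(\<lambda>i. i \<in> V \<and> x i)(j := b) = (\<lambda>i. i \<in> insert j V \<and> x i)"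
      using that by (intro ext) auto
    then show ?thesis by (simp add: G_def)
  qed
  have vars: "tree_vars (T b) \<subseteq> V \<union> (\<Union>w. tree_vars (F w))" for b
    using T(1)[of b] unfolding G_def by blast
  show ?case
  proof (intro exI[of _ "Query j (T False) (T True)"] conjI allI)
    show "tree_vars (Query j (T False) (T True)) \<subseteq> insert j V \<union> (\<Union>w. tree_vars (F w))"
      using vars[of False] vars[of True] by auto
    fix x
    show "run (Query j (T False) (T True)) x = run (F (\<lambda>i. i \<in> insert j V \<and> x i)) x"
      using upd[of x "x j"] by (cases "x j") (simp_all add: T(2))
    show "queried (Query j (T False) (T True)) x =
        insert j V \<union> queried (F (\<lambda>i. i \<in> insert j V \<and> x i)) x"
      using upd[of x "x j"] by (cases "x j") (simp_all add: T(3))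
  qed
qed

text \<open>Otherwise some point follows \<open>x\<close> on \<open>V\<close> and \<open>y\<close>
  on \<open>W\<close>, and \<open>f\<close> would take both values there.\<close>

lemma certificates_intersect:
  assumes "x \<in> cube n" "y \<in> cube n" "certifies n f x V" "certifies n f y W" "f x \<noteq> f y"
  shows "\<exists>i\<in>V \<inter> W. x i \<noteq> y i"
proof (rule ccontr)
  assume agree: "\<not> ?thesis"
  define p where "p i = (if i \<in> V then x i else y i)" for i
  have "p \<in> cube n" using assms(1,2) by (auto simp: mem_cube_iff p_def)
  moreover have "\<forall>i\<in>V. p i = x i" "\<forall>i\<in>W. p i = y i" using agree by (auto simp: p_def)
  ultimately have "f p = f x" "f p = f y" using assms(3,4) unfolding certifies_def by blast+
  with assms(5) show False by simp
qed

text \<open>Invariant of the rounds: \<open>z\<close> on \<open>U\<close> holds the answers so far,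
  and \<open>k\<close> bounds the unqueried part of some certificate of each consistent zero of
  \<open>f\<close>. A round queries at most \<open>c\<close> variables and lowers \<open>k\<close>
  by one.\<close>

lemma tree_if_certified:
  assumes "\<And>x. \<lbrakk>x \<in> cube n; \<forall>i\<in>U. x i = z i; \<not> f x\<rbrakk>
      \<Longrightarrow> \<exists>V. certifies n f x V \<and> card (V - U) \<le> k"
    and "\<And>x. \<lbrakk>x \<in> cube n; f x\<rbrakk> \<Longrightarrow> \<exists>V. certifies n f x V \<and> card V \<le> c"
  shows "\<exists>T. tree_vars T \<subseteq> {1..n} \<and>
           (\<forall>x\<in>cube n. (\<forall>i\<in>U. x i = z i) \<longrightarrow> run T x = f x \<and> card (queried T x) \<le> k * c)"
  using assms(1)
proof (induction k arbitrary: U z)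
  case 0
  \<comment> \<open>For \<open>k = 0\<close> a consistent zero has a certificate inside
    \<open>U\<close>, which fixes \<open>f\<close> on all consistent points; without such a zero
    \<open>f\<close> is true on all of them.\<close>
  have "\<exists>b. \<forall>x\<in>cube n. (\<forall>i\<in>U. x i = z i) \<longrightarrow> f x = b"
  proof (cases "\<exists>x\<in>cube n. (\<forall>i\<in>U. x i = z i) \<and> \<not> f x")
    case True
    then obtain x where x: "x \<in> cube n" "\<forall>i\<in>U. x i = z i" "\<not> f x" by blast
    with 0 obtain V where V: "certifies n f x V" "card (V - U) \<le> 0" by blast
    have "finite V" using V(1) finite_subset unfolding certifies_def by blast
    with V(2) have "V \<subseteq> U" by auto
    with V(1) x(2) have "\<forall>y\<in>cube n. (\<forall>i\<in>U. y i = z i) \<longrightarrow> f y = f x"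
      unfolding certifies_def by (metis subsetD)
    then show ?thesis by blast
  qed blast
  then obtain b where "\<forall>x\<in>cube n. (\<forall>i\<in>U. x i = z i) \<longrightarrow> f x = b" by blast
  then show ?case by (intro exI[of _ "Answer b"]) auto
next
  case (Suc k)
  show ?case
  proof (cases "\<exists>x\<in>cube n. (\<forall>i\<in>U. x i = z i) \<and> f x")
    case False
    then show ?thesis by (intro exI[of _ "Answer False"]) auto
  next
    case True
    then obtain x where x: "x \<in> cube n" "\<forall>i\<in>U. x i = z i" "f x" by blast
    with assms(2) obtain V where V: "certifies n f x V" "card V \<le> c" by blast
    have Vn: "V \<subseteq> {1..n}" and finV: "finite V"
      using V(1) finite_subset unfolding certifies_def by blast+
    \<comment> \<open>Old answers take precedence over the new ones \<open>w\<close>, since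
      \<open>V\<close> may meet \<open>U\<close>.\<close>
    define z' where "z' w i = (if i \<in> U then z i else w i)" for w :: "nat \<Rightarrow> bool" and i
    have "\<exists>T. tree_vars T \<subseteq> {1..n} \<and>
           (\<forall>y\<in>cube n. (\<forall>i\<in>U \<union> V. y i = z' w i) \<longrightarrow> run T y = f y \<and> card (queried T y) \<le> k * c)"
      for w
    proof (rule Suc.IH)
      fix y assume y: "y \<in> cube n" "\<forall>i\<in>U \<union> V. y i = z' w i" "\<not> f y"
      then have yU: "\<forall>i\<in>U. y i = z i" by (auto simp: z'_def)
      with Suc.prems y obtain W where W: "certifies n f y W" "card (W - U) \<le> Suc k" by blast
      have "finite W" using W(1) finite_subset unfolding certifies_def by blast
      \<comment> \<open>Both points follow \<open>z\<close> on \<open>U\<close>, so the variable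
        where they differ is new, and querying \<open>V\<close> removes it from the unqueried part
        of \<open>W\<close>.\<close>
      obtain i where "i \<in> V \<inter> W" "x i \<noteq> y i"
        using certificates_intersect[OF x(1) y(1) V(1) W(1)] x(3) y(3) by auto
      with x(2) yU have "i \<in> V \<inter> W - U" by auto
      then have "W - (U \<union> V) \<subset> W - U" by blast
      then have "card (W - (U \<union> V)) < card (W - U)"
        using \<open>finite W\<close> by (simp add: psubset_card_mono)
      with W show "\<exists>W. certifies n f y W \<and> card (W - (U \<union> V)) \<le> k" by force
    qed
    then obtain F where F: "\<And>w. tree_vars (F w) \<subseteq> {1..n}"
      "\<And>w y. \<lbrakk>y \<in> cube n; \<forall>i\<in>U \<union> V. y i = z' w i\<rbrakk>
         \<Longrightarrow> run (F w) y = f y \<and> card (queried (F w) y) \<le> k * c"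
      by metis
    obtain T where T: "tree_vars T \<subseteq> V \<union> (\<Union>w. tree_vars (F w))"
      "\<And>y. run T y = run (F (\<lambda>i. i \<in> V \<and> y i)) y"
      "\<And>y. queried T y = V \<union> queried (F (\<lambda>i. i \<in> V \<and> y i)) y"
      using query_all_tree[OF finV, of F] by blast
    show ?thesis
    proof (intro exI[of _ T] conjI ballI impI)
      show "tree_vars T \<subseteq> {1..n}" using T(1) F(1) Vn by blast
      fix y assume y: "y \<in> cube n" "\<forall>i\<in>U. y i = z i"
      then have "\<forall>i\<in>U \<union> V. y i = z' (\<lambda>i. i \<in> V \<and> y i) i" by (auto simp: z'_def)
      note Fy = F(2)[OF y(1) this]
      then show "run T y = f y" by (simp add: T(2))
      have "card (queried T y) \<le> card V + card (queried (F (\<lambda>i. i \<in> V \<and> y i)) y)"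
        unfolding T(3) by (rule card_Un_le)
      with Fy V(2) show "card (queried T y) \<le> Suc k * c" by simp
    qed
  qed
qed

lemma exact_tree_if_certified:
  assumes "\<And>x. x \<in> cube n \<Longrightarrow> \<exists>V. certifies n f x V \<and> card V \<le> c"
  shows "\<exists>T. tree_vars T \<subseteq> {1..n} \<and> (\<forall>x\<in>cube n. run T x = f x) \<and> query_cost n T \<le> c\<^sup>2"
proof -
  obtain T where "tree_vars T \<subseteq> {1..n}"
    "\<forall>x\<in>cube n. run T x = f x \<and> card (queried T x) \<le> c * c"
    using tree_if_certified[of n "{}" _ f c c] assms by auto
  moreover from this have "query_cost n T \<le> c\<^sup>2"
    unfolding query_cost_def power2_eq_square using finite_cube cube_nonempty by (subst Max_le_iff) auto
  ultimately show ?thesis by blast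
qed

lemma corr_under_le_corr:
  assumes "distribution_on_cube n \<nu>" "error_certificate n \<epsilon> b \<nu> f A"
  shows "corr_under n \<epsilon> b \<nu> f \<le> corr n \<epsilon> f"
proof -
  let ?S = "{corr_under n \<epsilon> b \<nu> f | b \<nu>.
     distribution_on_cube n \<nu> \<and> (\<exists>A. error_certificate n \<epsilon> b \<nu> f A)}"
  \<comment> \<open>There are infinitely many distributions, but this bound leaves finitely many
    values, as \<open>Max\<close> requires.\<close>
  have "corr_under n \<epsilon> b \<nu> f \<le> n" if "error_certificate n \<epsilon> b \<nu> f A" for b \<nu> A
  proof -
    have "corr_under n \<epsilon> b \<nu> f \<le> codim A"
      unfolding corr_under_def using that by (intro Least_le) blast
    also have "\<dots> \<le> card {1..n}"
      using that unfolding codim_def error_certificate_def assignment_def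
      by (intro card_mono) auto
    finally show ?thesis by simp
  qed
  then have "finite ?S" by (intro finite_subset[of ?S "{..n}"]) auto
  then show ?thesis unfolding corr_def using assms by (intro Max_ge) auto
qed

lemma codim_le_corr:
  assumes "distribution_on_cube n \<nu>" "error_certificate n \<epsilon> b \<nu> f A"
  obtains B where "error_certificate n \<epsilon> b \<nu> f B" "codim B \<le> corr n \<epsilon> f"
proof -
  have "\<exists>B. error_certificate n \<epsilon> b \<nu> f B \<and> corr_under n \<epsilon> b \<nu> f = codim B"
    unfolding corr_under_def by (rule LeastI_ex) (use assms(2) in blast)
  then show thesis using corr_under_le_corr[OF assms] that by metis
qed

lemma certificate_le_corr:
  assumes "x \<in> cube n" "0 \<le> \<epsilon>" "\<epsilon> < 1/2"
  shows "\<exists>V. certifies n f x V \<and> card V \<le> corr n \<epsilon> f"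
proof -
  define S where "S = insert x {y \<in> cube n. f y \<noteq> f x}"
  define \<nu> where "\<nu> = pmf_of_set S"
  have S: "finite S" "S \<noteq> {}" "S \<subseteq> cube n"
    using assms(1) finite_cube by (auto simp: S_def)
  have prob: "measure_pmf.prob \<nu> X = real (card (S \<inter> X)) / real (card S)" for X
    using S by (simp add: \<nu>_def measure_pmf_of_set)
  have "card S > 0" using S by (simp add: card_gt_0_iff)
  \<comment> \<open>The factor \<open>1 / card S\<close> cancels. If \<open>X\<close> misses
    \<open>S\<close>, both sides are 0, as division by zero gives 0.\<close>
  have cond: "\<P>(y in measure_pmf \<nu>. f y \<noteq> f x \<bar> y \<in> X) =
      real (card (X \<inter> {y \<in> cube n. f y \<noteq> f x})) / real (card (S \<inter> X))" for X
  proof -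
    have "S \<inter> {y. f y \<noteq> f x \<and> y \<in> X} = X \<inter> {y \<in> cube n. f y \<noteq> f x}"
      by (auto simp: S_def)
    then show ?thesis using \<open>card S > 0\<close> by (simp add: cond_prob_def prob)
  qed
  \<comment> \<open>The full assignment of \<open>x\<close> has error 0, so \<open>\<nu>\<close>
    with value \<open>f x\<close> is among the pairs that \<open>corr\<close> ranges over.\<close>
  define P where "P i = (if i \<in> {1..n} then Some (x i) else None)" for i
  have "subcube n P = {x}"
    using assms(1) by (fastforce simp: subcube_def P_def mem_cube_iff fun_eq_iff)
  moreover have "assignment n P" by (auto simp: assignment_def P_def split: if_splits)
  moreover have "S \<inter> {x} = {x}" by (simp add: S_def)
  ultimately have "error_certificate n \<epsilon> (f x) \<nu> f P"
    unfolding error_certificate_def cond prob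
    using assms(2) \<open>card S > 0\<close> by simp
  moreover have "distribution_on_cube n \<nu>"
    using S by (simp add: distribution_on_cube_def \<nu>_def)
  ultimately obtain A where
    A: "error_certificate n \<epsilon> (f x) \<nu> f A" and small: "codim A \<le> corr n \<epsilon> f"
    using codim_le_corr by metis
  define E where "E = subcube n A \<inter> {y \<in> cube n. f y \<noteq> f x}"
  have fin: "finite E" using finite_cube by (simp add: E_def)
  have pos: "card (S \<inter> subcube n A) > 0"
    using A \<open>card S > 0\<close> unfolding error_certificate_def prob
    by (simp add: zero_less_divide_iff)
  have err: "real (card E) / real (card (S \<inter> subcube n A)) \<le> \<epsilon>"
    using A unfolding error_certificate_def cond E_def by simp
  \<comment> \<open>Only \<open>x\<close> has the right value in \<open>S\<close>, so e wrong points
    give error at least e/(e+1), which is at least 1/2 unless e = 0.\<close>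
  have "S \<inter> subcube n A \<subseteq> insert x E" by (auto simp: S_def E_def)
  then have "card (S \<inter> subcube n A) \<le> card (insert x E)"
    using fin by (intro card_mono) auto
  also have "\<dots> \<le> Suc (card E)"
    using fin by (simp add: card_insert_if)
  finally have "card (S \<inter> subcube n A) \<le> Suc (card E)" .
  moreover have "real (card E) < real (card (S \<inter> subcube n A)) / 2"
  proof -
    have "real (card E) \<le> \<epsilon> * real (card (S \<inter> subcube n A))"
      using err pos by (simp add: divide_le_eq)
    also have "\<dots> < 1/2 * real (card (S \<inter> subcube n A))"
      using assms(3) pos by (intro mult_strict_right_mono) auto
    finally show ?thesis by simp
  qed
  ultimately have "card E = 0" by linarith
  with fin have "E = {}" by simp
  \<comment> \<open>The subcube has positive weight and no wrong point, so the point of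
    \<open>S\<close> in it is \<open>x\<close>.\<close>
  then have xA: "x \<in> subcube n A"
    using pos by (force simp: S_def E_def card_gt_0_iff)
  have "f y = f x" if "y \<in> cube n" "\<forall>i\<in>dom A. y i = x i" for y
  proof -
    have "A i = Some (y i) \<or> A i = None" if "i \<in> {1..n}" for i
    proof (cases "A i")
      case (Some b)
      have "A i = Some (x i) \<or> A i = None"
        using xA \<open>i \<in> {1..n}\<close> unfolding subcube_def mem_Collect_eq by (elim conjE bspec)
      moreover have "y i = x i" using Some \<open>\<forall>i\<in>dom A. y i = x i\<close> by blast
      ultimately show ?thesis using Some by simp
    qed simp
    with that(1) have "y \<in> subcube n A"
      unfolding subcube_def mem_Collect_eq by (intro conjI ballI)
    with that(1) \<open>E = {}\<close> show ?thesis by (auto simp: E_def)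
  qed
  then have "certifies n f x (dom A)"
    using A by (auto simp: certifies_def error_certificate_def assignment_def)
  with small show ?thesis unfolding codim_def by blast
qed

theorem theorem17:
  shows "\<exists>K::real. K > 0 \<and>
    (\<forall>(n::nat) (f :: (nat \<Rightarrow> bool) \<Rightarrow> bool) (\<epsilon>::real) (\<mu> :: (nat \<Rightarrow> bool) pmf).
       1 \<le> n \<longrightarrow> 0 \<le> \<epsilon> \<longrightarrow> \<epsilon> < 1/2 \<longrightarrow> product_distribution n \<mu> \<longrightarrow>
       real (dist_query_complexity n \<mu> (4 * \<epsilon>) f) \<le> K * (real (corr n \<epsilon> f))\<^sup>2)"
proof (intro exI[of _ 1] conjI allI impI)
  fix n f and \<epsilon> :: real and \<mu> :: "(nat \<Rightarrow> bool) pmf"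
  assume \<epsilon>: "0 \<le> \<epsilon>" "\<epsilon> < 1/2" and "product_distribution n \<mu>"
  then have supp: "set_pmf \<mu> \<subseteq> cube n"
    by (auto simp: product_distribution_def cube_def set_Pi_pmf PiE_dflt_def)
  obtain T where T: "tree_vars T \<subseteq> {1..n}" "\<forall>x\<in>cube n. run T x = f x"
      "query_cost n T \<le> (corr n \<epsilon> f)\<^sup>2"
    using exact_tree_if_certified[OF certificate_le_corr[OF _ \<epsilon>]] by blast
  \<comment> \<open>\<open>T\<close> is exact on the cube, which contains the support of
    \<open>\<mu>\<close>; success probability 1 meets the threshold
    \<open>1 - 4 * \<epsilon>\<close>.\<close>
  have "measure_pmf.prob \<mu> {x. run T x = f x} = 1"
    using supp T(2) by (subst measure_pmf.prob_eq_1) (auto simp: AE_measure_pmf_iff)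
  with T(1) \<epsilon> have "dist_query_complexity n \<mu> (4 * \<epsilon>) f \<le> query_cost n T"
    unfolding dist_query_complexity_def by (intro Least_le exI[of _ T]) auto
  with T(3) have "dist_query_complexity n \<mu> (4 * \<epsilon>) f \<le> (corr n \<epsilon> f)\<^sup>2" by linarith
  then show "real (dist_query_complexity n \<mu> (4 * \<epsilon>) f) \<le> 1 * (real (corr n \<epsilon> f))\<^sup>2"
    by (metis mult_1 of_nat_le_iff of_nat_power)
qed simp

end
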